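(* Let $G$ be a connected non-bipartite graph. Then $\mathbb{S}(G)=\mathbb{S}_1(G)\cup\mathbb{S}_2(G)\cup\mathbb{S}_3(G)\cup\cdots$.
   Context: Graphs are finite and simple. A signed graph $\Gamma=(G,\sigma)$ on $G$ is $G$ with a function $\sigma:E(G)\to\{+1,-1\}$. Switching $\Gamma$ with respect to $U\subseteq V(G)$ reverses the signs of all edges between $U$ and $V(G)\setminus U$. $\Gamma\simeq\Gamma'$ (switching isomorphic) means $\Gamma$ is isomorphic, by a sign-preserving graph isomorphism, to a switching of $\Gamma'$. $\Gamma$ is sign-symmetric if $\Gamma\simeq-\Gamma$, where $-\Gamma=(G,-\sigma)$. $\mathbb{S}(G)$ is the set of all sign-symmetric signed graphs on $G$. The sign of a cycle is the product of the signs of its edges. A weak automorphism of $\Gamma$ is a $\varphi\in Aut(G)$ (automorphism of the unsigned graph) with $\sigma(\varphi(C))=-\sigma(C)$ for every odd cycle $C$ of $G$ and $\sigma(\varphi(C))=\sigma(C)$ for every even cycle $C$. A weak automorphism of $\Gamma$ is principal (a PWA) if it has the smallest order among all weak automorphisms of $\Gamma$. For an integer $r\ge1$, $\mathbb{S}_r(G)=\{\Gamma\in\mathbb{S}(G)\mid \Gamma \text{ has a principal weak automorphism of order } 2r\}$. *)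

theory Defs
  imports "HOL-Algebra.Bij" "HOL-Algebra.Multiplicative_Group"
begin

record 'a ugraph =
  verts :: "'a set"
  edges :: "'a set set"

definition fin_simple_graph :: "'a ugraph \<Rightarrow> bool" where
  "fin_simple_graph G \<longleftrightarrow>
     finite (verts G) \<and> (\<forall>e\<in>edges G. e \<subseteq> verts G \<and> card e = 2)"

definition graph_connected :: "'a ugraph \<Rightarrow> bool" where
  "graph_connected G \<longleftrightarrow> verts G \<noteq> {} \<and>
     (\<forall>u\<in>verts G. \<forall>v\<in>verts G. (u, v) \<in> {(x, y). {x, y} \<in> edges G}\<^sup>*)"

definition graph_bipartite :: "'a ugraph \<Rightarrow> bool" where
  "graph_bipartite G \<longleftrightarrow>
     (\<exists>A B. A \<union> B = verts G \<and> A \<inter> B = {} \<and>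
        (\<forall>e\<in>edges G. \<exists>a\<in>A. \<exists>b\<in>B. e = {a, b}))"

definition graph_iso :: "'a ugraph \<Rightarrow> 'b ugraph \<Rightarrow> ('a \<Rightarrow> 'b) \<Rightarrow> bool" where
  "graph_iso G H f \<longleftrightarrow> bij_betw f (verts G) (verts H) \<and>
     (\<forall>u\<in>verts G. \<forall>v\<in>verts G. {u, v} \<in> edges G \<longleftrightarrow> {f u, f v} \<in> edges H)"

text \<open>Automorphisms are taken extensional, hence as elements of the group
  \<open>BijGroup (verts G)\<close>, in which their order is computed.\<close>

definition graph_Aut :: "'a ugraph \<Rightarrow> ('a \<Rightarrow> 'a) set" where
  "graph_Aut G = {\<phi> \<in> carrier (BijGroup (verts G)). graph_iso G G \<phi>}"

definition aut_order :: "'a ugraph \<Rightarrow> ('a \<Rightarrow> 'a) \<Rightarrow> nat" where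
  "aut_order G \<phi> = group.ord (BijGroup (verts G)) \<phi>"

text \<open>A cycle is given by its edge set, so its length is the cardinality and its image
  under a vertex map \<open>\<phi>\<close> is \<open>(`) \<phi> ` C\<close>.\<close>

definition is_cycle :: "'a ugraph \<Rightarrow> 'a set set \<Rightarrow> bool" where
  "is_cycle G C \<longleftrightarrow> C \<subseteq> edges G \<and>
     (\<exists>vs. distinct vs \<and> length vs \<ge> 3 \<and>
        C = {{vs ! i, vs ! (Suc i mod length vs)} | i. i < length vs})"

text \<open>A signed graph is a pair \<open>(G, \<sigma>)\<close>; \<open>\<sigma>\<close> is extensional, so that
  equality of pairs is equality of signed graphs.\<close>

type_synonym 'a sgraph = "'a ugraph \<times> ('a set \<Rightarrow> int)"

definition signed_graphs_on :: "'a ugraph \<Rightarrow> 'a sgraph set" where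
  "signed_graphs_on G = {G} \<times> (edges G \<rightarrow>\<^sub>E {1, -1})"

fun neg_sgraph :: "'a sgraph \<Rightarrow> 'a sgraph" where
  "neg_sgraph (G, \<sigma>) = (G, \<lambda>e\<in>edges G. - \<sigma> e)"

fun switching :: "'a set \<Rightarrow> 'a sgraph \<Rightarrow> 'a sgraph" where
  "switching U (G, \<sigma>) =
     (G, \<lambda>e\<in>edges G. if e \<inter> U \<noteq> {} \<and> e \<inter> (verts G - U) \<noteq> {} then - \<sigma> e else \<sigma> e)"

definition sgraph_isomorphic :: "'a sgraph \<Rightarrow> 'b sgraph \<Rightarrow> bool" where
  "sgraph_isomorphic \<Gamma> \<Gamma>' \<longleftrightarrow>
     (\<exists>f. graph_iso (fst \<Gamma>) (fst \<Gamma>') f \<and> (\<forall>e\<in>edges (fst \<Gamma>). snd \<Gamma>' (f ` e) = snd \<Gamma> e))"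

definition switching_isomorphic :: "'a sgraph \<Rightarrow> 'b sgraph \<Rightarrow> bool" where
  "switching_isomorphic \<Gamma> \<Gamma>' \<longleftrightarrow>
     (\<exists>U \<subseteq> verts (fst \<Gamma>'). sgraph_isomorphic \<Gamma> (switching U \<Gamma>'))"

definition sign_symmetric :: "'a sgraph \<Rightarrow> bool" where
  "sign_symmetric \<Gamma> \<longleftrightarrow> switching_isomorphic \<Gamma> (neg_sgraph \<Gamma>)"

definition sign_symmetric_on :: "'a ugraph \<Rightarrow> 'a sgraph set" where
  "sign_symmetric_on G = {\<Gamma> \<in> signed_graphs_on G. sign_symmetric \<Gamma>}"

definition cycle_sign :: "'a sgraph \<Rightarrow> 'a set set \<Rightarrow> int" where
  "cycle_sign \<Gamma> C = (\<Prod>e\<in>C. snd \<Gamma> e)"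

definition weak_automorphism :: "'a sgraph \<Rightarrow> ('a \<Rightarrow> 'a) \<Rightarrow> bool" where
  "weak_automorphism \<Gamma> \<phi> \<longleftrightarrow> \<phi> \<in> graph_Aut (fst \<Gamma>) \<and>
     (\<forall>C. is_cycle (fst \<Gamma>) C \<longrightarrow>
        (odd (card C) \<longrightarrow> cycle_sign \<Gamma> ((`) \<phi> ` C) = - cycle_sign \<Gamma> C) \<and>
        (even (card C) \<longrightarrow> cycle_sign \<Gamma> ((`) \<phi> ` C) = cycle_sign \<Gamma> C))"

definition principal_weak_automorphism :: "'a sgraph \<Rightarrow> ('a \<Rightarrow> 'a) \<Rightarrow> bool" where
  "principal_weak_automorphism \<Gamma> \<phi> \<longleftrightarrow> weak_automorphism \<Gamma> \<phi> \<and>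
     (\<forall>\<psi>. weak_automorphism \<Gamma> \<psi> \<longrightarrow> aut_order (fst \<Gamma>) \<phi> \<le> aut_order (fst \<Gamma>) \<psi>)"

definition sign_symmetric_PWA :: "nat \<Rightarrow> 'a ugraph \<Rightarrow> 'a sgraph set" where
  "sign_symmetric_PWA r G = {\<Gamma> \<in> sign_symmetric_on G.
     \<exists>\<phi>. principal_weak_automorphism \<Gamma> \<phi> \<and> aut_order G \<phi> = 2 * r}"

end

(* A sign-symmetry of \<Gamma> is an automorphism of G that is a weak automorphism, because
   switching does not change the signs of cycles; hence a principal weak automorphism exists.
   A weak automorphism \<phi> flips the sign of every odd cycle, so \<phi>^k multiplies that sign by
   (-1)^k. A non-bipartite graph has an odd cycle, and taking k to be the order of \<phi> shows
   that the order is even. *)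

theory Submission
  imports Defs
begin

section \<open>Odd cycles in non-bipartite graphs\<close>

abbreviation adj :: "'a ugraph \<Rightarrow> 'a rel" where
  "adj G \<equiv> {(x, y). {x, y} \<in> edges G}"

lemma relpow_sub_walk:
  assumes "\<And>i. i < n \<Longrightarrow> (f i, f (Suc i)) \<in> R" and "i \<le> j" and "j \<le> n"
  shows "(f i, f j) \<in> R ^^ (j - i)"
  unfolding relpow_fun_conv
  using assms by (intro exI[of _ "\<lambda>k. f (i + k)"]) auto

lemma sym_relpow: "sym R \<Longrightarrow> (x, y) \<in> R ^^ n \<Longrightarrow> (y, x) \<in> R ^^ n"
proof (induction n arbitrary: y)
  case (Suc n)
  then obtain z where "(x, z) \<in> R ^^ n" "(z, y) \<in> R" by auto
  with Suc have "(z, x) \<in> R ^^ n" "(y, z) \<in> R" by (auto dest: symD)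
  then show ?case by (rule relpow_Suc_I2[rotated])
qed auto

text \<open>Two positions with the same edge either agree or traverse it in opposite directions. In
  the second case each position is the cyclic successor of the other, so the length divides 2, which
  length at least 3 excludes. Injectivity lets cardinalities and products over the edge set be
  computed over positions.\<close>

lemma cycle_edges_inj_on:
  assumes "distinct vs" and "length vs \<ge> 3"
  shows "inj_on (\<lambda>i. {vs ! i, vs ! (Suc i mod length vs)}) {..<length vs}"
proof (rule inj_onI)
  fix i j
  let ?n = "length vs"
  assume ij: "i \<in> {..<?n}" "j \<in> {..<?n}"
    and eq: "{vs ! i, vs ! (Suc i mod ?n)} = {vs ! j, vs ! (Suc j mod ?n)}"
  have lt: "Suc i mod ?n < ?n" "Suc j mod ?n < ?n" by (rule mod_less_divisor, use assms(2) in linarith)+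
  from eq have "vs ! i = vs ! j \<or> (vs ! i = vs ! (Suc j mod ?n) \<and> vs ! (Suc i mod ?n) = vs ! j)"
    by (auto simp: doubleton_eq_iff)
  then have "i = j \<or> (i = Suc j mod ?n \<and> Suc i mod ?n = j)"
    using assms(1) ij lt by (simp add: nth_eq_iff_index_eq)
  then show "i = j" using assms(2) ij by (auto simp: mod_Suc split: if_splits)
qed

lemma cycle_image:
  "{{vs ! i, vs ! (Suc i mod length vs)} | i. i < length vs} =
    (\<lambda>i. {vs ! i, vs ! (Suc i mod length vs)}) ` {..<length vs}"
  by auto

lemma card_cycle:
  assumes "distinct vs" and "length vs \<ge> 3"
  shows "card {{vs ! i, vs ! (Suc i mod length vs)} | i. i < length vs} = length vs"
  unfolding cycle_image using card_image[OF cycle_edges_inj_on[OF assms]] by simp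

text \<open>A shortest odd closed walk is a cycle: a repeated vertex would split it into two shorter
  closed walks, one of them odd.\<close>

lemma odd_cycle_of_odd_closed_walk:
  assumes G: "fin_simple_graph G" and walk: "(v, v) \<in> adj G ^^ n" "odd n"
  obtains C where "is_cycle G C" and "odd (card C)"
proof -
  \<comment> \<open>The minimum is taken over all base vertices, since the piece cut out at a
    repeated vertex is based there and not at the original start.\<close>
  define m where "m = (LEAST n. odd n \<and> (\<exists>v. (v, v) \<in> adj G ^^ n))"
  have m: "odd m \<and> (\<exists>v. (v, v) \<in> adj G ^^ m)"
    unfolding m_def by (rule LeastI[of _ n]) (use walk in auto)
  have least: "m \<le> k" if "odd k" "(u, u) \<in> adj G ^^ k" for k u
    unfolding m_def by (rule Least_le) (use that in auto)
  from m obtain f where f: "f 0 = f m" "\<And>i. i < m \<Longrightarrow> (f i, f (Suc i)) \<in> adj G"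
    unfolding relpow_fun_conv by metis
  have walk_f: "(f i, f j) \<in> adj G ^^ (j - i)" if "i \<le> j" "j \<le> m" for i j
    using f(2) that by (rule relpow_sub_walk[where n = m])
  have neq: "f i \<noteq> f j" if "i < j" "j < m" for i j
  proof
    assume eq: "f i = f j"
    have "(f i, f j) \<in> adj G ^^ (j - i)" using walk_f[of i j] that by auto
    then have inner: "(f i, f i) \<in> adj G ^^ (j - i)" using eq by simp
    have "(f 0, f i) \<in> adj G ^^ i" "(f j, f m) \<in> adj G ^^ (m - j)"
      using walk_f[of 0 i] walk_f[of j m] that by auto
    then have "(f 0, f 0) \<in> adj G ^^ (i + (m - j))"
      unfolding relpow_add using eq f(1) by auto
    \<comment> \<open>Since \<open>i < j < m\<close>, both pieces are strictly shorter than
      \<open>m\<close>, so minimality makes both lengths even, while they add up to the odd number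
      \<open>m\<close>.\<close>
    then have "even (i + (m - j))" using least[of "i + (m - j)" "f 0"] that by fastforce
    moreover have "even (j - i)" using least[of "j - i" "f i"] inner that by fastforce
    ultimately have "even (j - i + (i + (m - j)))" by simp
    moreover have "j - i + (i + (m - j)) = m" using that by simp
    ultimately show False using m by simp
  qed
  \<comment> \<open>Length 1 would be a loop, whose edge has only one element. An odd length other
    than 1 is at least 3.\<close>
  have "m \<noteq> 1"
  proof
    assume "m = 1"
    then have "{f 0} \<in> edges G" using f by force
    then show False using G by (force simp: fin_simple_graph_def)
  qed
  moreover from m have "odd m" by simp
  ultimately have m3: "m \<ge> 3" by presburger
  \<comment> \<open>The final vertex \<open>f m\<close> is left out because it equals
    \<open>f 0\<close>; the successor modulo \<open>m\<close> closes the cycle.\<close>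
  define vs where "vs = map f [0..<m]"
  have len: "length vs = m" by (simp add: vs_def)
  have dist: "distinct vs"
    unfolding vs_def distinct_map using neq by (auto intro!: inj_onI) (metis linorder_neqE_nat)
  have "{vs ! i, vs ! (Suc i mod m)} \<in> edges G" if "i < m" for i
  proof (cases "Suc i = m")
    case True
    then show ?thesis using f(2)[OF that] f(1) that by (simp add: vs_def)
  next
    case False
    then show ?thesis using f(2)[OF that] that by (simp add: vs_def)
  qed
  then have "is_cycle G {{vs ! i, vs ! (Suc i mod length vs)} | i. i < length vs}"
    unfolding is_cycle_def using dist len m3 by (auto intro!: exI[of _ vs])
  moreover have "odd (card {{vs ! i, vs ! (Suc i mod length vs)} | i. i < length vs})"
    using card_cycle[OF dist] len m3 m by simp
  ultimately show ?thesis by (rule that)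
qed

text \<open>Vertices are sorted by the parity of the walks reaching them from a root. Every edge
  joins the two classes, so they would form a bipartition if disjoint. A common vertex yields an odd
  closed walk: out along an even walk, back along a reversed odd one.\<close>

lemma odd_cycle_of_nonbipartite:
  assumes G: "fin_simple_graph G" and conn: "graph_connected G" and nb: "\<not> graph_bipartite G"
  obtains C where "is_cycle G C" and "odd (card C)"
proof -
  have sym: "sym (adj G)" by (auto simp: sym_def insert_commute)
  from conn obtain r where r: "r \<in> verts G" by (auto simp: graph_connected_def)
  define A where "A = {v \<in> verts G. \<exists>n. even n \<and> (r, v) \<in> adj G ^^ n}"
  define B where "B = {v \<in> verts G. \<exists>n. odd n \<and> (r, v) \<in> adj G ^^ n}"
  have AB: "A \<union> B = verts G"
  proof -
    have "\<exists>n. (r, v) \<in> adj G ^^ n" if "v \<in> verts G" for v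
      using conn r that unfolding graph_connected_def by (metis rtrancl_power)
    then show ?thesis unfolding A_def B_def by blast
  qed
  have step: "(u \<in> A \<longrightarrow> v \<in> B) \<and> (u \<in> B \<longrightarrow> v \<in> A)" if "{u, v} \<in> edges G" for u v
  proof -
    have "v \<in> verts G" using that G by (auto simp: fin_simple_graph_def)
    moreover have "(r, v) \<in> adj G ^^ Suc n" if "(r, u) \<in> adj G ^^ n" for n
      using that \<open>{u, v} \<in> edges G\<close> by auto
    ultimately show ?thesis unfolding A_def B_def
      using even_Suc by blast
  qed
  have "\<exists>a\<in>A. \<exists>b\<in>B. e = {a, b}" if "e \<in> edges G" for e
  proof -
    from that G obtain u v where e: "e = {u, v}" "u \<in> verts G" "v \<in> verts G"
      by (auto simp: fin_simple_graph_def card_2_iff)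
    show ?thesis
    proof (cases "u \<in> A")
      case True
      then show ?thesis using step[of u v] that e by auto
    next
      case False
      then have "u \<in> B" using e AB by auto
      then have "v \<in> A" using step[of u v] that e by auto
      then show ?thesis using \<open>u \<in> B\<close> e by (metis insert_commute)
    qed
  qed
  then have "graph_bipartite G" if "A \<inter> B = {}"
    unfolding graph_bipartite_def using AB that by (intro exI conjI ballI) auto
  then have "A \<inter> B \<noteq> {}" using nb by blast
  then obtain v k l where "even k" "odd l" "(r, v) \<in> adj G ^^ k" "(r, v) \<in> adj G ^^ l"
    unfolding A_def B_def by blast
  then have "(r, r) \<in> adj G ^^ (k + l)" "odd (k + l)"
    using sym_relpow[OF sym] unfolding relpow_add by auto
  then show ?thesis using odd_cycle_of_odd_closed_walk[OF G] that by blast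
qed

section \<open>Signs of cycles\<close>

lemma prod_cycle:
  assumes "distinct vs" and "length vs \<ge> 3"
  shows "prod g {{vs ! i, vs ! (Suc i mod length vs)} | i. i < length vs} =
    (\<Prod>i<length vs. g {vs ! i, vs ! (Suc i mod length vs)})"
  unfolding cycle_image by (simp add: prod.reindex[OF cycle_edges_inj_on[OF assms]])

text \<open>The cyclic successor permutes the indices; only the last one wraps round, contributing
  \<open>h 0\<close>. This equates the product over the heads of the cycle's edges with the product
  over their tails.\<close>

lemma prod_cyclic_shift:
  fixes h :: "nat \<Rightarrow> 'b::comm_monoid_mult"
  shows "(\<Prod>i<n. h (Suc i mod n)) = (\<Prod>i<n. h i)"
proof (cases n)
  case (Suc m)
  have "(\<Prod>i<Suc m. h (Suc i mod Suc m)) = (\<Prod>i<m. h (Suc i)) * h 0" by simp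
  also have "\<dots> = (\<Prod>i<Suc m. h i)" by (simp only: prod.lessThan_Suc_shift mult.commute)
  finally show ?thesis using Suc by simp
qed simp

text \<open>Switching multiplies the sign of an edge by a factor 1 or -1 for each endpoint. Every
  vertex of a cycle lies on two of its edges, so its factor enters squared.\<close>

lemma cycle_sign_switching:
  assumes G: "fin_simple_graph G" and C: "is_cycle G C"
  shows "cycle_sign (switching U (G, \<sigma>)) C = cycle_sign (G, \<sigma>) C"
proof -
  define s :: "'a \<Rightarrow> int" where "s v = (if v \<in> U then -1 else 1)" for v
  from C obtain vs where vs: "distinct vs" "length vs \<ge> 3"
    and Cvs: "C = {{vs ! i, vs ! (Suc i mod length vs)} | i. i < length vs}"
    and sub: "C \<subseteq> edges G" by (auto simp: is_cycle_def)
  let ?n = "length vs"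
  let ?e = "\<lambda>i. {vs ! i, vs ! (Suc i mod ?n)}"
  have sw: "snd (switching U (G, \<sigma>)) (?e i) = \<sigma> (?e i) * (s (vs ! i) * s (vs ! (Suc i mod ?n)))"
    if "i < ?n" for i
  proof -
    \<comment> \<open>Membership in \<open>edges G\<close> resolves the restriction in
      \<open>switching\<close>; containment in \<open>verts G\<close> makes lying outside
      \<open>U\<close> the same as lying in \<open>verts G - U\<close>.\<close>
    have "?e i \<in> edges G" using that sub Cvs by blast
    moreover from this have "?e i \<subseteq> verts G" using G by (auto simp: fin_simple_graph_def)
    ultimately show ?thesis by (auto simp: s_def)
  qed
  have "cycle_sign (switching U (G, \<sigma>)) C =
      (\<Prod>i<?n. \<sigma> (?e i) * (s (vs ! i) * s (vs ! (Suc i mod ?n))))"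
    unfolding cycle_sign_def Cvs prod_cycle[OF vs] by (intro prod.cong refl sw) simp
  also have "\<dots> = (\<Prod>i<?n. \<sigma> (?e i)) * ((\<Prod>i<?n. s (vs ! i)) * (\<Prod>i<?n. s (vs ! i)))"
    by (simp add: prod.distrib prod_cyclic_shift[of "\<lambda>i. s (vs ! i)"])
  also have "(\<Prod>i<?n. s (vs ! i)) * (\<Prod>i<?n. s (vs ! i)) = 1"
    unfolding prod.distrib[symmetric] by (intro prod.neutral) (simp add: s_def)
  finally show ?thesis unfolding cycle_sign_def Cvs prod_cycle[OF vs] by simp
qed

lemma cycle_sign_neg:
  assumes "C \<subseteq> edges G"
  shows "cycle_sign (neg_sgraph (G, \<sigma>)) C = (-1) ^ card C * cycle_sign (G, \<sigma>) C"
proof -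
  have "cycle_sign (neg_sgraph (G, \<sigma>)) C = (\<Prod>e\<in>C. (-1) * \<sigma> e)"
    unfolding cycle_sign_def using assms by (intro prod.cong) auto
  then show ?thesis unfolding cycle_sign_def prod.distrib prod_constant snd_conv .
qed

text \<open>A nonzero sign differs from its negative, which is what the parity argument uses. For
  infinite \<open>C\<close> the product is 1 by convention.\<close>

lemma cycle_sign_nonzero:
  assumes "\<Gamma> \<in> signed_graphs_on G" and "C \<subseteq> edges G"
  shows "cycle_sign \<Gamma> C \<noteq> 0"
proof -
  have "snd \<Gamma> e \<noteq> 0" if "e \<in> C" for e
    using assms that by (force simp: signed_graphs_on_def)
  then show ?thesis
    unfolding cycle_sign_def by (cases "finite C") auto
qed

section \<open>Automorphisms acting on cycles\<close>

text \<open>Used to see that a cycle and its image have equally many edges, and to reindex the sign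
  of the image as a product over the original edges.\<close>

lemma inj_on_image_edges:
  assumes G: "fin_simple_graph G" and f: "bij_betw f (verts G) (verts H)" and C: "C \<subseteq> edges G"
  shows "inj_on ((`) f) C"
proof (rule inj_on_subset)
  show "inj_on ((`) f) (Pow (verts G))"
    using f by (auto simp: bij_betw_def intro: inj_on_image_Pow)
  show "C \<subseteq> Pow (verts G)" using G C by (auto simp: fin_simple_graph_def)
qed

lemma is_cycle_image:
  assumes G: "fin_simple_graph G" and f: "graph_iso G H f" and C: "is_cycle G C"
  shows "is_cycle H ((`) f ` C)"
proof -
  from C obtain vs where vs: "distinct vs" "length vs \<ge> 3"
    and Cvs: "C = {{vs ! i, vs ! (Suc i mod length vs)} | i. i < length vs}"
    and sub: "C \<subseteq> edges G" by (auto simp: is_cycle_def)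
  let ?n = "length vs"
  let ?e = "\<lambda>i. {vs ! i, vs ! (Suc i mod ?n)}"
  have e: "?e i \<in> edges G" "?e i \<subseteq> verts G" if "i < ?n" for i
  proof -
    show "?e i \<in> edges G" using that sub Cvs by blast
    then show "?e i \<subseteq> verts G" using G by (auto simp: fin_simple_graph_def)
  qed
  have "inj_on f (set vs)"
  proof (rule inj_on_subset)
    show "inj_on f (verts G)" using f by (simp add: graph_iso_def bij_betw_def)
    show "set vs \<subseteq> verts G" using e(2) by (fastforce simp: in_set_conv_nth)
  qed
  then have dist: "distinct (map f vs)" using vs by (simp add: distinct_map)
  have im: "f ` ?e i = {map f vs ! i, map f vs ! (Suc i mod ?n)}" if "i < ?n" for i
  proof -
    have "Suc i mod ?n < ?n" by (rule mod_less_divisor) (use that in linarith)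
    then show ?thesis using that by simp
  qed
  have "(`) f ` C = (\<lambda>i. f ` ?e i) ` {..<?n}" unfolding Cvs cycle_image image_image ..
  also have "\<dots> = (\<lambda>i. {map f vs ! i, map f vs ! (Suc i mod ?n)}) ` {..<?n}"
    by (intro image_cong refl im) simp
  finally have "(`) f ` C = {{map f vs ! i, map f vs ! (Suc i mod length (map f vs))} | i.
      i < length (map f vs)}" unfolding cycle_image[of "map f vs"] by simp
  moreover note dist
  moreover have "(`) f ` C \<subseteq> edges H"
  proof -
    have "f ` ?e i \<in> edges H" if "i < ?n" for i
      using e[OF that] f unfolding graph_iso_def by simp
    then show ?thesis unfolding Cvs by blast
  qed
  moreover have "length (map f vs) \<ge> 3" using vs(2) by simp
  ultimately show ?thesis unfolding is_cycle_def by blast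
qed

text \<open>A sign-symmetry is an arbitrary function outside the vertices, whereas elements of
  \<open>graph_Aut\<close> are extensional. Restriction bridges the two without changing the action
  on the graph.\<close>

lemma graph_iso_restrict:
  "graph_iso G H (restrict f (verts G)) \<longleftrightarrow> graph_iso G H f"
  unfolding graph_iso_def by (simp cong: bij_betw_cong)

lemma image_image_restrict:
  assumes "fin_simple_graph G" and "C \<subseteq> edges G"
  shows "(`) (restrict f (verts G)) ` C = (`) f ` C"
proof (rule image_cong[OF refl])
  fix e assume "e \<in> C"
  then have "e \<subseteq> verts G" using assms by (auto simp: fin_simple_graph_def)
  then show "restrict f (verts G) ` e = f ` e" by (intro image_cong) auto
qed

lemma weak_automorphism_of_sign_symmetric:
  assumes G: "fin_simple_graph G" and ss: "sign_symmetric (G, \<sigma>)"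
  obtains \<phi> where "weak_automorphism (G, \<sigma>) \<phi>"
proof -
  from ss obtain U f where f: "graph_iso G G f"
    and sgn: "\<And>e. e \<in> edges G \<Longrightarrow> snd (switching U (neg_sgraph (G, \<sigma>))) (f ` e) = \<sigma> e"
    unfolding sign_symmetric_def switching_isomorphic_def sgraph_isomorphic_def by auto
  let ?\<phi> = "restrict f (verts G)"
  \<comment> \<open>Signs are pulled back along \<open>f\<close>, so the sign of \<open>C\<close> is
    expressed through that of its image. As the factor is its own inverse, the odd and even cases
    give the two clauses of a weak automorphism.\<close>
  have "cycle_sign (G, \<sigma>) C = (-1) ^ card C * cycle_sign (G, \<sigma>) ((`) f ` C)"
    if C: "is_cycle G C" for C
  proof -
    have sub: "C \<subseteq> edges G" using C by (simp add: is_cycle_def)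
    have inj: "inj_on ((`) f) C" using inj_on_image_edges[OF G _ sub] f by (auto simp: graph_iso_def)
    have fC: "is_cycle G ((`) f ` C)" by (rule is_cycle_image[OF G f C])
    have "cycle_sign (G, \<sigma>) C = (\<Prod>e\<in>C. snd (switching U (neg_sgraph (G, \<sigma>))) (f ` e))"
      unfolding cycle_sign_def snd_conv using sub by (intro prod.cong refl sgn[symmetric]) blast
    also have "\<dots> = cycle_sign (switching U (neg_sgraph (G, \<sigma>))) ((`) f ` C)"
      unfolding cycle_sign_def by (simp only: prod.reindex[OF inj] o_def)
    also have "\<dots> = cycle_sign (neg_sgraph (G, \<sigma>)) ((`) f ` C)"
      unfolding neg_sgraph.simps by (rule cycle_sign_switching[OF G fC])
    also have "\<dots> = (-1) ^ card C * cycle_sign (G, \<sigma>) ((`) f ` C)"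
      using cycle_sign_neg[of "(`) f ` C" G \<sigma>] fC card_image[OF inj] by (simp add: is_cycle_def)
    finally show ?thesis .
  qed
  moreover have "?\<phi> \<in> graph_Aut G"
    using f by (auto simp: graph_Aut_def graph_iso_restrict BijGroup_def Bij_def graph_iso_def
        cong: bij_betw_cong)
  moreover have "(`) ?\<phi> ` C = (`) f ` C" if "is_cycle G C" for C
    using that by (intro image_image_restrict[OF G]) (simp add: is_cycle_def)
  ultimately have "weak_automorphism (G, \<sigma>) ?\<phi>"
    unfolding weak_automorphism_def by simp
  then show ?thesis by (rule that)
qed

section \<open>Orders of weak automorphisms\<close>

lemma finite_BijGroup: "finite S \<Longrightarrow> finite (carrier (BijGroup S))"
  by (rule finite_subset[OF _ finite_PiE[of S "\<lambda>_. S"]])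
    (auto simp: BijGroup_def Bij_def bij_betw_def PiE_def extensional_def)

text \<open>The sign flip can be iterated because the image of an odd cycle is again an odd cycle.
  The induction therefore has to vary \<open>C\<close>.\<close>

lemma weak_automorphism_pow_odd_cycle:
  assumes G: "fin_simple_graph G" and \<phi>: "weak_automorphism (G, \<sigma>) \<phi>"
    and C: "is_cycle G C" "odd (card C)"
  shows "cycle_sign (G, \<sigma>) ((`) (\<phi> [^]\<^bsub>BijGroup (verts G)\<^esub> (k::nat)) ` C) =
    (-1) ^ k * cycle_sign (G, \<sigma>) C"
  using C
proof (induction k arbitrary: C)
  case 0
  have "(`) (restrict (\<lambda>x. x) (verts G)) ` C = C"
    using image_image_restrict[OF G, of C "\<lambda>x. x"] 0 by (simp add: is_cycle_def)
  then show ?case by (simp add: BijGroup_def)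
next
  case (Suc k)
  let ?B = "BijGroup (verts G)"
  interpret group ?B by (rule group_BijGroup)
  from \<phi> have carr: "\<phi> \<in> carrier ?B" and iso: "graph_iso G G \<phi>"
    by (auto simp: weak_automorphism_def graph_Aut_def)
  have sub: "C \<subseteq> edges G" using Suc.prems by (simp add: is_cycle_def)
  have inj: "inj_on ((`) \<phi>) C" using inj_on_image_edges[OF G _ sub] iso by (auto simp: graph_iso_def)
  have mult: "f \<otimes>\<^bsub>?B\<^esub> g = restrict (f \<circ> g) (verts G)"
    if "f \<in> carrier ?B" "g \<in> carrier ?B" for f g
    using that by (simp add: BijGroup_def compose_def o_def)
  \<comment> \<open>The extra factor acts first, so the induction hypothesis is applied to the image
    cycle under \<open>\<phi>\<close>.\<close>
  have "\<phi> [^]\<^bsub>?B\<^esub> Suc k = restrict (\<phi> [^]\<^bsub>?B\<^esub> k \<circ> \<phi>) (verts G)"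
    unfolding nat_pow_Suc by (rule mult[OF nat_pow_closed[OF carr] carr])
  then have "(`) (\<phi> [^]\<^bsub>?B\<^esub> Suc k) ` C = (`) (\<phi> [^]\<^bsub>?B\<^esub> k) ` ((`) \<phi> ` C)"
    using image_image_restrict[OF G sub] by (simp add: image_image image_comp)
  moreover have "is_cycle G ((`) \<phi> ` C)" "odd (card ((`) \<phi> ` C))"
    using is_cycle_image[OF G iso Suc.prems(1)] Suc.prems(2) card_image[OF inj] by auto
  moreover have "cycle_sign (G, \<sigma>) ((`) \<phi> ` C) = - cycle_sign (G, \<sigma>) C"
    using \<phi> Suc.prems by (simp add: weak_automorphism_def)
  ultimately show ?case using Suc.IH by simp
qed

lemma even_order_weak_automorphism:
  assumes G: "fin_simple_graph G" and \<Gamma>: "(G, \<sigma>) \<in> signed_graphs_on G"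
    and \<phi>: "weak_automorphism (G, \<sigma>) \<phi>" and C: "is_cycle G C" "odd (card C)"
  shows "even (aut_order G \<phi>)"
proof (rule ccontr)
  assume odd: "odd (aut_order G \<phi>)"
  interpret group "BijGroup (verts G)" by (rule group_BijGroup)
  have "\<phi> \<in> carrier (BijGroup (verts G))"
    using \<phi> by (auto simp: weak_automorphism_def graph_Aut_def)
  then have "\<phi> [^]\<^bsub>BijGroup (verts G)\<^esub> aut_order G \<phi> = \<phi> [^]\<^bsub>BijGroup (verts G)\<^esub> (0::nat)"
    by (simp add: aut_order_def pow_ord_eq_1)
  then have "(-1) ^ aut_order G \<phi> * cycle_sign (G, \<sigma>) C = (-1) ^ 0 * cycle_sign (G, \<sigma>) C"
    using weak_automorphism_pow_odd_cycle[OF G \<phi> C] by metis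
  then have "cycle_sign (G, \<sigma>) C = 0" using odd by simp
  then show False using cycle_sign_nonzero[OF \<Gamma>] C by (auto simp: is_cycle_def)
qed

theorem proposition3p1:
  fixes G :: "'a ugraph"
  assumes "fin_simple_graph G"
    and "graph_connected G"
    and "\<not> graph_bipartite G"
  shows "sign_symmetric_on G = (\<Union>r\<in>{1..}. sign_symmetric_PWA r G)"
proof
  show "(\<Union>r\<in>{1..}. sign_symmetric_PWA r G) \<subseteq> sign_symmetric_on G"
    by (auto simp: sign_symmetric_PWA_def)
  show "sign_symmetric_on G \<subseteq> (\<Union>r\<in>{1..}. sign_symmetric_PWA r G)"
  proof
    fix \<Gamma> assume \<Gamma>: "\<Gamma> \<in> sign_symmetric_on G"
    then obtain \<sigma> where \<sigma>: "\<Gamma> = (G, \<sigma>)" "(G, \<sigma>) \<in> signed_graphs_on G" "sign_symmetric (G, \<sigma>)"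
      by (auto simp: sign_symmetric_on_def signed_graphs_on_def)
    obtain \<psi> where \<psi>: "weak_automorphism \<Gamma> \<psi>"
      using weak_automorphism_of_sign_symmetric[OF assms(1) \<sigma>(3)] \<sigma>(1) by auto
    obtain \<phi> where \<phi>: "principal_weak_automorphism \<Gamma> \<phi>"
      using ex_has_least_nat[of "weak_automorphism \<Gamma>" \<psi> "aut_order (fst \<Gamma>)"] \<psi>
      by (auto simp: principal_weak_automorphism_def)
    then have wa: "weak_automorphism (G, \<sigma>) \<phi>" using \<sigma> by (simp add: principal_weak_automorphism_def)
    obtain C where "is_cycle G C" "odd (card C)"
      using odd_cycle_of_nonbipartite[OF assms] .
    then have "even (aut_order G \<phi>)" by (rule even_order_weak_automorphism[OF assms(1) \<sigma>(2) wa])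
    then obtain r where r: "aut_order G \<phi> = 2 * r" by (auto elim: evenE)
    interpret group "BijGroup (verts G)" by (rule group_BijGroup)
    \<comment> \<open>Evenness alone would allow order 0, the value of \<open>ord\<close> at
      elements of infinite order. Finiteness of the group excludes it, giving
      \<open>r \<ge> 1\<close>.\<close>
    have "aut_order G \<phi> \<ge> 1" unfolding aut_order_def
      using wa assms(1)
      by (intro ord_ge_1 finite_BijGroup)
        (auto simp: weak_automorphism_def graph_Aut_def fin_simple_graph_def)
    then have "r \<ge> 1" using r by simp
    then show "\<Gamma> \<in> (\<Union>r\<in>{1..}. sign_symmetric_PWA r G)"
      using \<Gamma> \<phi> r unfolding sign_symmetric_PWA_def by auto
  qed
qed

end
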